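(* Let $\Gamma\subset\mathbb{R}^n$ be an open symmetric convex cone with vertex at the origin, with $\partial\Gamma\neq\emptyset$ and $\Gamma_n\subseteq\Gamma$. There exists a constant $\vartheta_\Gamma>0$ depending only on $\Gamma$ such that the following holds. Let $f$ be a smooth symmetric function on $\Gamma$ such that $f$ is concave in $\Gamma$ and $$\lim_{t\to+\infty}f(t\lambda)>f(\mu)\quad\text{for all }\lambda,\mu\in\Gamma .$$ Then $f_i(\lambda)\geq 0$ for all $1\leq i\leq n$ and $\sum_{i=1}^n f_i(\lambda)>0$ for all $\lambda\in\Gamma$, and for every $\lambda\in\Gamma$ with $\lambda_1\leq\cdots\leq\lambda_n$, $$f_i(\lambda)\geq\vartheta_\Gamma\sum_{j=1}^n f_j(\lambda),\qquad \forall\,1\leq i\leq\kappa_\Gamma+1 .$$ In particular, if $\Gamma$ is of type 2, then $f$ is of fully uniform ellipticity in $\Gamma$.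
   Context: $\Gamma_n=\{\lambda\in\mathbb{R}^n:\lambda_i>0\ \forall i\}$ is the positive cone. "Symmetric" means invariant under permutations of coordinates. $f_i=\partial f/\partial\lambda_i$. $\kappa_\Gamma=\max\{k:(\underbrace{0,\cdots,0}_{k},\underbrace{1,\cdots,1}_{n-k})\in\Gamma\}$. $\Gamma$ is of type 1 if the positive $\lambda_i$ axes belong to $\partial\Gamma$; otherwise it is of type 2. $f$ is of fully uniform ellipticity in $\Gamma$ if $f_i\geq0$ for all $i$ and $\sum_i f_i>0$ in $\Gamma$, and there is a uniform constant $\vartheta>0$ such that $f_i(\lambda)\geq\vartheta\sum_{j=1}^n f_j(\lambda)$ for all $\lambda\in\Gamma$ and all $1\leq i\leq n$. *)

theory Defs
  imports "HOL-Analysis.Analysis" "HOL-Combinatorics.Permutations"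
begin

text \<open>
  R^n is \<open>real ^ 'n\<close> with a finite, linearly ordered index type; \<open>coord_index i\<close> is the
  position (1, ..., n) of the index \<open>i\<close>, so \<open>\<lambda>\<^sub>1, ..., \<lambda>\<^sub>n\<close> are the components in increasing order of
  their index.
\<close>

definition coord_index :: "'n::{finite,linorder} \<Rightarrow> nat" where
  "coord_index i = card {j. j \<le> i}"

definition positive_cone :: "(real ^ 'n) set" where
  "positive_cone = {x. \<forall>i. 0 < x $ i}"

definition permute_coords :: "('n \<Rightarrow> 'n) \<Rightarrow> real ^ 'n \<Rightarrow> real ^ 'n" where
  "permute_coords p x = (\<chi> i. x $ p i)"

definition symmetric_set :: "(real ^ 'n) set \<Rightarrow> bool" where
  "symmetric_set \<Gamma> \<longleftrightarrow> (\<forall>p x. p permutes UNIV \<longrightarrow> x \<in> \<Gamma> \<longrightarrow> permute_coords p x \<in> \<Gamma>)"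

definition symmetric_fun_on :: "(real ^ 'n) set \<Rightarrow> (real ^ 'n \<Rightarrow> real) \<Rightarrow> bool" where
  "symmetric_fun_on \<Gamma> f \<longleftrightarrow> (\<forall>p x. p permutes UNIV \<longrightarrow> x \<in> \<Gamma> \<longrightarrow> f (permute_coords p x) = f x)"

text \<open>The library predicate \<^const>\<open>cone\<close> forces the vertex into the set, so it cannot hold of a nonempty
  open cone other than the whole space; here the scaling factors are strictly positive.\<close>

definition open_cone :: "(real ^ 'n) set \<Rightarrow> bool" where
  "open_cone \<Gamma> \<longleftrightarrow> open \<Gamma> \<and> (\<forall>x\<in>\<Gamma>. \<forall>t>0. t *\<^sub>R x \<in> \<Gamma>)"

definition partial_deriv :: "'n \<Rightarrow> (real ^ 'n \<Rightarrow> real) \<Rightarrow> real ^ 'n \<Rightarrow> real" where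
  "partial_deriv i f x = deriv (\<lambda>t. f (x + t *\<^sub>R axis i 1)) 0"

text \<open>For open \<open>S\<close> this is the usual notion of a \<open>C\<^sup>k\<close> function; it is only used for open sets.\<close>

primrec Ck_on :: "nat \<Rightarrow> (real ^ 'n) set \<Rightarrow> (real ^ 'n \<Rightarrow> real) \<Rightarrow> bool" where
  "Ck_on 0 S f \<longleftrightarrow> continuous_on S f"
| "Ck_on (Suc k) S f \<longleftrightarrow> f differentiable_on S \<and> (\<forall>i. Ck_on k S (partial_deriv i f))"

definition smooth_on :: "(real ^ 'n) set \<Rightarrow> (real ^ 'n \<Rightarrow> real) \<Rightarrow> bool" where
  "smooth_on S f \<longleftrightarrow> (\<forall>k. Ck_on k S f)"

text \<open>The limit along a ray is taken in the extended reals: it may be infinite.\<close>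

definition ray_limit_condition :: "(real ^ 'n) set \<Rightarrow> (real ^ 'n \<Rightarrow> real) \<Rightarrow> bool" where
  "ray_limit_condition \<Gamma> f \<longleftrightarrow>
     (\<forall>x\<in>\<Gamma>. \<forall>y\<in>\<Gamma>. \<exists>L::ereal. ((\<lambda>t. ereal (f (t *\<^sub>R x))) \<longlongrightarrow> L) at_top \<and> L > ereal (f y))"

definition kappa :: "(real ^ 'n::{finite,linorder}) set \<Rightarrow> nat" where
  "kappa \<Gamma> = Max {k. k \<le> CARD('n) \<and> (\<chi> i. if coord_index i \<le> k then 0 else 1) \<in> \<Gamma>}"

definition type1 :: "(real ^ 'n) set \<Rightarrow> bool" where
  "type1 \<Gamma> \<longleftrightarrow> (\<forall>i. \<forall>t>0. axis i t \<in> frontier \<Gamma>)"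

definition type2 :: "(real ^ 'n) set \<Rightarrow> bool" where
  "type2 \<Gamma> \<longleftrightarrow> \<not> type1 \<Gamma>"

definition fully_uniformly_elliptic :: "(real ^ 'n) set \<Rightarrow> (real ^ 'n \<Rightarrow> real) \<Rightarrow> bool" where
  "fully_uniformly_elliptic \<Gamma> f \<longleftrightarrow>
     (\<forall>x\<in>\<Gamma>. (\<forall>i. partial_deriv i f x \<ge> 0) \<and> (\<Sum>i\<in>UNIV. partial_deriv i f x) > 0) \<and>
     (\<exists>\<theta>>0. \<forall>x\<in>\<Gamma>. \<forall>i. partial_deriv i f x \<ge> \<theta> * (\<Sum>j\<in>UNIV. partial_deriv j f x))"

end

theory Submission
  imports Defs
begin

text \<open>
  Concavity gives \<open>f (t \<mu>) - f x \<le> t Df(x) \<mu> - Df(x) x\<close>, so the growth along rays forces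
  \<open>Df(x) \<mu> > 0\<close> for all \<open>x, \<mu> \<in> \<Gamma>\<close>: first for \<open>\<mu> = x\<close>, then for every \<open>\<mu>\<close>. The gradient is
  thus in the dual cone of \<open>\<Gamma>\<close>. By symmetry and concavity its entries decrease when those of \<open>x\<close>
  increase, and testing it against \<open>(-\<epsilon>, \<dots>, -\<epsilon>, 1, \<dots>, 1) \<in> \<Gamma>\<close> with \<open>\<kappa>\<close> negative entries
  bounds the entries up to index \<open>\<kappa> + 1\<close> below. In type 2 the vectors \<open>e\<^sub>i - \<epsilon> (1, \<dots>, 1)\<close> are in
  \<open>\<Gamma>\<close> and bound every entry.
\<close>

section \<open>Directional derivatives and tangent bounds\<close>

lemma has_derivative_imp_directional_derivative:
  fixes f :: "'a::real_normed_vector \<Rightarrow> real"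
  assumes "(f has_derivative D) (at x)"
  shows "((\<lambda>t. f (x + t *\<^sub>R v)) has_field_derivative D v) (at 0)"
proof -
  interpret D: bounded_linear D using assms by (rule has_derivative_bounded_linear)
  have "((\<lambda>t. x + t *\<^sub>R v) has_derivative (\<lambda>t. t *\<^sub>R v)) (at (0::real))"
    by (auto intro!: derivative_eq_intros)
  from has_derivative_compose[OF this, of f D]
  have "((\<lambda>t. f (x + t *\<^sub>R v)) has_derivative (\<lambda>t. D (t *\<^sub>R v))) (at 0)"
    using assms by simp
  then show ?thesis
    by (simp add: has_field_derivative_def D.scaleR mult_commute_abs)
qed

lemma has_derivative_imp_partial_deriv:
  assumes "(f has_derivative D) (at x)"
  shows "partial_deriv i f x = D (axis i 1)"
  unfolding partial_deriv_def
  by (rule DERIV_imp_deriv[OF has_derivative_imp_directional_derivative[OF assms]])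

lemma has_derivative_eq_sum_partial_deriv:
  assumes "(f has_derivative D) (at x)"
  shows "D v = (\<Sum>i\<in>UNIV. v $ i * partial_deriv i f x)"
proof -
  interpret D: bounded_linear D using assms by (rule has_derivative_bounded_linear)
  have "D v = D (\<Sum>i\<in>UNIV. v $ i *\<^sub>R axis i 1)"
    using basis_expansion[of v] by (simp add: scalar_mult_eq_scaleR)
  also have "\<dots> = (\<Sum>i\<in>UNIV. v $ i * D (axis i 1))"
    by (simp add: D.sum D.scaleR)
  finally show ?thesis
    by (simp add: has_derivative_imp_partial_deriv[OF assms])
qed

text \<open>By concavity the difference quotient from \<open>x\<close> towards \<open>y\<close> at
  any step \<open>t\<close> in (0,1) is at least \<open>f y - f x\<close>; letting \<open>t\<close>
  decrease to 0 turns the quotient into \<open>D (y - x)\<close>.\<close>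

lemma concave_on_below_tangent:
  fixes f :: "'a::real_normed_vector \<Rightarrow> real"
  assumes conc: "concave_on S f" and D: "(f has_derivative D) (at x)"
    and x: "x \<in> S" and y: "y \<in> S"
  shows "f y - f x \<le> D (y - x)"
proof -
  have "((\<lambda>t. f (x + t *\<^sub>R (y - x))) has_field_derivative D (y - x)) (at 0)"
    by (rule has_derivative_imp_directional_derivative[OF D])
  then have "((\<lambda>t. (f (x + t *\<^sub>R (y - x)) - f x) / t) \<longlongrightarrow> D (y - x)) (at 0)"
    by (simp add: has_field_derivative_iff)
  then have lim: "((\<lambda>t. (f (x + t *\<^sub>R (y - x)) - f x) / t) \<longlongrightarrow> D (y - x)) (at_right 0)"
    by (rule filterlim_mono[OF _ order_refl]) (simp add: at_le)
  have "f y - f x \<le> (f (x + t *\<^sub>R (y - x)) - f x) / t" if t: "0 < t" "t < 1" for t :: real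
  proof -
    have "(1 - t) * f x + t * f y \<le> f ((1 - t) *\<^sub>R x + t *\<^sub>R y)"
      using concave_onD[OF conc, of t x y] x y t by simp
    also have "(1 - t) *\<^sub>R x + t *\<^sub>R y = x + t *\<^sub>R (y - x)"
      by (simp add: algebra_simps)
    finally show ?thesis
      using t by (simp add: field_simps)
  qed
  then have "eventually (\<lambda>t. f y - f x \<le> (f (x + t *\<^sub>R (y - x)) - f x) / t) (at_right 0)"
    unfolding eventually_at_right_field by (intro exI[of _ 1]) auto
  then show ?thesis
    by (rule tendsto_lowerbound[OF lim]) simp
qed

text \<open>Turns openness into a margin \<open>e\<close>; the ellipticity constants are built from
  such margins, hence from the cone alone.\<close>

lemma open_diff_small_scaleR:
  fixes v u :: "'a::real_normed_vector"
  assumes "open S" "v \<in> S"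
  obtains e :: real where "e > 0" "v - e *\<^sub>R u \<in> S"
proof -
  have "((\<lambda>e. v - e *\<^sub>R u) \<longlongrightarrow> v - 0 *\<^sub>R u) (at_right 0)"
    by (intro tendsto_intros)
  then have "eventually (\<lambda>e. v - e *\<^sub>R u \<in> S) (at_right 0)"
    using assms by (auto dest: topological_tendstoD)
  then have "eventually (\<lambda>e. v - e *\<^sub>R u \<in> S \<and> e > 0) (at_right 0)"
    using eventually_at_right_less[of 0] by (rule eventually_conj)
  then show thesis
    using that eventually_happens'[OF trivial_limit_at_right_real] by blast
qed

lemma ray_limit_condition_imp_derivative_pos:
  assumes cone: "open_cone \<Gamma>" and conc: "concave_on \<Gamma> f" and ray: "ray_limit_condition \<Gamma> f"
    and D: "(f has_derivative D) (at x)" and x: "x \<in> \<Gamma>" and \<mu>: "\<mu> \<in> \<Gamma>"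
  shows "D \<mu> > 0"
proof -
  interpret D: bounded_linear D using D by (rule has_derivative_bounded_linear)
  \<comment> \<open>The tangent bound at \<open>t *\<^sub>R y\<close> reads
    \<open>f (t *\<^sub>R y) - f x \<le> t * D y - D x\<close>, and the left side is positive for
    large \<open>t\<close>. Asking for \<open>t > 1\<close> lets the case \<open>y = x\<close> yield
    \<open>(t - 1) * D x > 0\<close> with a positive factor.\<close>
  have ex: "\<exists>t>1. t * D y > D x" if y: "y \<in> \<Gamma>" for y
  proof -
    obtain L where L: "((\<lambda>t. ereal (f (t *\<^sub>R y))) \<longlongrightarrow> L) at_top" "L > ereal (f x)"
      using ray x y unfolding ray_limit_condition_def by blast
    have "eventually (\<lambda>t. f (t *\<^sub>R y) > f x) at_top"
      using order_tendstoD(1)[OF L] by simp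
    then obtain t where t: "t > 1" "f (t *\<^sub>R y) > f x"
      using eventually_happens[OF eventually_conj[OF _ eventually_gt_at_top[of "1::real"]]]
      by (metis trivial_limit_at_top_linorder)
    have "t *\<^sub>R y \<in> \<Gamma>"
      using cone y t unfolding open_cone_def by simp
    from concave_on_below_tangent[OF conc D x this] t show ?thesis
      by (auto simp: D.diff D.scaleR)
  qed
  obtain t where t: "t > 1" "t * D x > D x"
    using ex[OF x] by blast
  then have "0 < (t - 1) * D x"
    by (simp add: algebra_simps)
  then have "D x > 0"
    using t by (simp add: zero_less_mult_iff)
  moreover obtain s where s: "s > 1" "s * D \<mu> > D x"
    using ex[OF \<mu>] by blast
  ultimately have "s * D \<mu> > 0" by linarith
  then show ?thesis
    using s by (simp add: zero_less_mult_iff)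
qed

section \<open>Coordinate swaps and the ordering of the gradient\<close>

lemma permute_coords_transpose:
  "permute_coords (Transposition.transpose i j) x
     = x + (x $ j - x $ i) *\<^sub>R axis i 1 - (x $ j - x $ i) *\<^sub>R axis j 1"
proof -
  have "x $ Transposition.transpose i j k
      = x $ k + (x $ j - x $ i) * axis i 1 $ k - (x $ j - x $ i) * axis j 1 $ k" for k
    by (cases "k = i"; cases "k = j") (simp_all add: axis_def)
  then show ?thesis
    by (simp add: vec_eq_iff permute_coords_def)
qed

lemma permute_coords_transpose_axis:
  "permute_coords (Transposition.transpose i j) (axis j a) = axis i a"
proof -
  have "axis j a $ Transposition.transpose i j k = axis i a $ k" for k
    by (cases "k = i"; cases "k = j") (simp_all add: axis_def)
  then show ?thesis
    by (simp add: vec_eq_iff permute_coords_def)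
qed

lemma permute_coords_add_scaleR:
  "permute_coords p (x + c *\<^sub>R y) = permute_coords p x + c *\<^sub>R permute_coords p y"
  by (simp add: vec_eq_iff permute_coords_def)

lemma permute_coords_one [simp]: "permute_coords p 1 = 1"
  by (simp add: vec_eq_iff permute_coords_def)

lemma symmetric_concave_partial_deriv_antimono:
  assumes "open \<Gamma>" and sym: "symmetric_set \<Gamma>" and symf: "symmetric_fun_on \<Gamma> f"
    and conc: "concave_on \<Gamma> f" and D: "(f has_derivative D) (at x)"
    and x: "x \<in> \<Gamma>" and le: "x $ i \<le> x $ j"
  shows "partial_deriv j f x \<le> partial_deriv i f x"
proof -
  interpret D: bounded_linear D using D by (rule has_derivative_bounded_linear)
  let ?p = "Transposition.transpose i j"
  have p: "?p permutes UNIV" by (simp add: permutes_swap_id)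
  show ?thesis
  proof (cases "x $ i = x $ j")
    case True
    \<comment> \<open>The swap fixes \<open>x\<close> and exchanges the two coordinate lines through
      it. Symmetry of \<open>f\<close> holds on \<open>\<Gamma>\<close>, so the functions on these
      lines are compared near 0, which determines their derivatives.\<close>
    have "((\<lambda>t. x + t *\<^sub>R axis i 1) \<longlongrightarrow> x + 0 *\<^sub>R axis i 1) (nhds (0::real))"
      by (intro tendsto_intros filterlim_ident)
    then have "eventually (\<lambda>t. x + t *\<^sub>R axis i 1 \<in> \<Gamma>) (nhds (0::real))"
      using \<open>open \<Gamma>\<close> x by (auto dest: topological_tendstoD)
    then have "eventually (\<lambda>t. f (x + t *\<^sub>R axis i 1) = f (x + t *\<^sub>R axis j 1)) (nhds (0::real))"
    proof eventually_elim
      case (elim t)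
      have "permute_coords ?p (x + t *\<^sub>R axis i 1) = x + t *\<^sub>R axis j 1"
        using True permute_coords_transpose_axis[of j i]
        by (simp add: permute_coords_add_scaleR permute_coords_transpose[of j i x]
            transpose_commute[of i j])
      then show ?case
        using symf p elim unfolding symmetric_fun_on_def by metis
    qed
    then have "partial_deriv i f x = partial_deriv j f x"
      unfolding partial_deriv_def by (rule deriv_cong_ev) simp
    then show ?thesis by simp
  next
    case False
    \<comment> \<open>The swapped point has the same value, so the tangent bound has left side 0;
      the displacement is a positive multiple of \<open>axis i 1 - axis j 1\<close>.\<close>
    have "permute_coords ?p x \<in> \<Gamma>" "f (permute_coords ?p x) = f x"
      using sym symf p x unfolding symmetric_set_def symmetric_fun_on_def by auto
    with concave_on_below_tangent[OF conc D x]
    have "0 \<le> D (permute_coords ?p x - x)" by fastforce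
    also have "\<dots> = (x $ j - x $ i) * (partial_deriv i f x - partial_deriv j f x)"
      by (simp add: permute_coords_transpose D.diff D.add D.scaleR algebra_simps
          has_derivative_imp_partial_deriv[OF D])
    finally show ?thesis
      using False le by (simp add: zero_le_mult_iff)
  qed
qed

section \<open>Test vectors in the cone\<close>

lemma coord_index_strict_mono: "i < j \<Longrightarrow> coord_index i < coord_index j"
  unfolding coord_index_def by (rule psubset_card_mono) (auto simp flip: atMost_def)

lemma kappa_vector_mem:
  fixes \<Gamma> :: "(real ^ ('n::{finite,linorder})) set"
  assumes "positive_cone \<subseteq> \<Gamma>"
  shows "(\<chi> i. if coord_index i \<le> kappa \<Gamma> then 0 else 1) \<in> \<Gamma>"
proof -
  let ?K = "{k. k \<le> CARD('n) \<and> ((\<chi> i::'n. if coord_index i \<le> k then 0 else 1) :: (real, 'n) vec) \<in> \<Gamma>}"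
  \<comment> \<open>Positions start at 1, so \<open>k = 0\<close> gives the all-ones vector and the
    set under \<open>Max\<close> is nonempty.\<close>
  have pos: "coord_index i > 0" for i :: 'n
    unfolding coord_index_def by (auto simp: card_gt_0_iff)
  have "((\<chi> i::'n. if coord_index i \<le> 0 then 0 else 1) :: (real, 'n) vec) \<in> positive_cone"
    using pos by (auto simp: positive_cone_def simp flip: neq0_conv)
  then have "0 \<in> ?K" using assms by blast
  moreover have "finite ?K" by (rule finite_subset[of _ "{..CARD('n)}"]) auto
  ultimately have "Max ?K \<in> ?K" by (intro Max_in) auto
  then show ?thesis unfolding kappa_def by blast
qed

text \<open>A positive axis point is a limit of points of the positive cone, so it lies in the
  closure; off the frontier it is interior. Type 2 supplies one such point, and scaling and swaps
  reach every axis.\<close>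

lemma type2_axis_mem:
  assumes cone: "open_cone \<Gamma>" and sym: "symmetric_set \<Gamma>"
    and pos: "positive_cone \<subseteq> \<Gamma>" and "type2 \<Gamma>"
  shows "axis i 1 \<in> \<Gamma>"
proof -
  obtain j t where t: "t > 0" "axis j t \<notin> frontier \<Gamma>"
    using \<open>type2 \<Gamma>\<close> unfolding type2_def type1_def by blast
  have lim: "((\<lambda>d. axis j t + d *\<^sub>R 1) \<longlongrightarrow> axis j t + 0 *\<^sub>R 1) (at_right (0::real))"
    by (intro tendsto_intros)
  have "eventually (\<lambda>d. axis j t + d *\<^sub>R 1 \<in> closure \<Gamma>) (at_right (0::real))"
    using eventually_at_right_less[of "0::real"]
  proof eventually_elim
    case (elim d)
    then have "axis j t + d *\<^sub>R 1 \<in> positive_cone"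
      using t by (simp add: positive_cone_def axis_def)
    then show ?case using pos closure_subset by blast
  qed
  from Lim_in_closed_set[OF closed_closure this _ lim]
  have "axis j t \<in> closure \<Gamma>" by simp
  with t have "axis j t \<in> interior \<Gamma>" by (simp add: frontier_def)
  then have "axis j t \<in> \<Gamma>" using interior_subset by blast
  then have "(1 / t) *\<^sub>R axis j t \<in> \<Gamma>"
    using cone t unfolding open_cone_def by simp
  moreover have "(1 / t) *\<^sub>R axis j t = axis j 1"
    using t by (simp add: vec_eq_iff axis_def)
  ultimately have "axis j 1 \<in> \<Gamma>" by simp
  then have "permute_coords (Transposition.transpose i j) (axis j 1) \<in> \<Gamma>"
    using sym unfolding symmetric_set_def by (simp add: permutes_swap_id)
  then show ?thesis by (simp add: permute_coords_transpose_axis)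
qed

text \<open>A margin found for one axis serves all of them, since swaps fix the all-ones
  vector.\<close>

lemma type2_uniform_axis_mem:
  assumes cone: "open_cone \<Gamma>" and sym: "symmetric_set \<Gamma>"
    and pos: "positive_cone \<subseteq> \<Gamma>" and "type2 \<Gamma>"
  obtains e where "e > 0" "\<And>i. axis i 1 - e *\<^sub>R 1 \<in> \<Gamma>"
proof -
  fix j :: 'a
  have "open \<Gamma>" using cone by (simp add: open_cone_def)
  then obtain e where e: "e > 0" "axis j 1 - e *\<^sub>R 1 \<in> \<Gamma>"
    using open_diff_small_scaleR type2_axis_mem[OF assms] by blast
  have "axis i 1 - e *\<^sub>R 1 \<in> \<Gamma>" for i
  proof -
    have "permute_coords (Transposition.transpose i j) (axis j 1 - e *\<^sub>R 1) \<in> \<Gamma>"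
      using sym e unfolding symmetric_set_def by (simp add: permutes_swap_id)
    then show ?thesis
      using permute_coords_add_scaleR[of _ "axis j 1" "- e" 1]
      by (simp add: permute_coords_transpose_axis)
  qed
  with e that show thesis by blast
qed

theorem theorem1p4:
  fixes \<Gamma> :: "(real ^ ('n::{finite,linorder})) set"
  assumes "open_cone \<Gamma>" and "convex \<Gamma>" and "symmetric_set \<Gamma>"
    and "frontier \<Gamma> \<noteq> {}" and "positive_cone \<subseteq> \<Gamma>"
  shows "\<exists>\<theta>>0. \<forall>f.
    smooth_on \<Gamma> f \<longrightarrow> symmetric_fun_on \<Gamma> f \<longrightarrow> concave_on \<Gamma> f \<longrightarrow> ray_limit_condition \<Gamma> f \<longrightarrow>
      (\<forall>x\<in>\<Gamma>. (\<forall>i. partial_deriv i f x \<ge> 0) \<and> (\<Sum>i\<in>UNIV. partial_deriv i f x) > 0) \<and>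
      (\<forall>x\<in>\<Gamma>. (\<forall>i j. i \<le> j \<longrightarrow> x $ i \<le> x $ j) \<longrightarrow>
        (\<forall>i. coord_index i \<le> kappa \<Gamma> + 1 \<longrightarrow>
           partial_deriv i f x \<ge> \<theta> * (\<Sum>j\<in>UNIV. partial_deriv j f x))) \<and>
      (type2 \<Gamma> \<longrightarrow> fully_uniformly_elliptic \<Gamma> f)"
proof -
  let ?k = "kappa \<Gamma>"
  have op: "open \<Gamma>" using assms(1) by (simp add: open_cone_def)
  \<comment> \<open>Chosen before \<open>f\<close> is introduced: the vector defining
    \<open>kappa\<close> stays in the cone when its zeros become \<open>- e\<close>.\<close>
  obtain e where e: "e > 0"
    and emem: "(\<chi> i. if coord_index i \<le> ?k then 0 else 1)
      - e *\<^sub>R (\<chi> i. if coord_index i \<le> ?k then 1 else 0) \<in> \<Gamma>"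
    using open_diff_small_scaleR[OF op kappa_vector_mem[OF assms(5)]] by blast
  let ?n = "real CARD('n)"
  have n: "?n > 0" by simp
  \<comment> \<open>The value that makes the chain
    \<open>e * (A + B) \<le> (1 + e) * B \<le> (1 + e) * (?n * ?p i)\<close> in \<open>head\<close>
    close.\<close>
  define \<theta> where "\<theta> = e / ((1 + e) * ?n)"
  have "\<theta> > 0" using e n by (simp add: \<theta>_def)
  moreover have
      "(\<forall>x\<in>\<Gamma>. (\<forall>i. partial_deriv i f x \<ge> 0) \<and> (\<Sum>i\<in>UNIV. partial_deriv i f x) > 0) \<and>
      (\<forall>x\<in>\<Gamma>. (\<forall>i j. i \<le> j \<longrightarrow> x $ i \<le> x $ j) \<longrightarrow>
        (\<forall>i. coord_index i \<le> ?k + 1 \<longrightarrow>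
           partial_deriv i f x \<ge> \<theta> * (\<Sum>j\<in>UNIV. partial_deriv j f x))) \<and>
      (type2 \<Gamma> \<longrightarrow> fully_uniformly_elliptic \<Gamma> f)"
    if sm: "smooth_on \<Gamma> f" and symf: "symmetric_fun_on \<Gamma> f"
      and conc: "concave_on \<Gamma> f" and ray: "ray_limit_condition \<Gamma> f" for f
  proof -
    have "Ck_on (Suc 0) \<Gamma> f"
      using sm unfolding smooth_on_def by blast
    then have "\<forall>x\<in>\<Gamma>. \<exists>D. (f has_derivative D) (at x)"
      using op by (simp add: differentiable_on_eq_differentiable_at differentiable_def)
    then obtain D where D: "\<And>x. x \<in> \<Gamma> \<Longrightarrow> (f has_derivative D x) (at x)"
      by metis
    have pos: "(\<Sum>i\<in>UNIV. v $ i * partial_deriv i f x) > 0" if "x \<in> \<Gamma>" "v \<in> \<Gamma>" for x v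
      using ray_limit_condition_imp_derivative_pos[OF assms(1) conc ray D that] that(1)
      by (simp add: has_derivative_eq_sum_partial_deriv[OF D])
    have sum_pos: "(\<Sum>i\<in>UNIV. partial_deriv i f x) > 0" if "x \<in> \<Gamma>" for x
      using pos[OF that, of 1] subsetD[OF assms(5), of 1] by (simp add: positive_cone_def)
    \<comment> \<open>Used with \<open>d > 0\<close> for nonnegativity of the partial derivatives
      and with a negative coefficient in the type 2 case.\<close>
    have axis_sum: "(\<Sum>j\<in>UNIV. (axis i 1 + d *\<^sub>R 1 :: (real, 'n) vec) $ j * partial_deriv j f x)
        = partial_deriv i f x + d * (\<Sum>j\<in>UNIV. partial_deriv j f x)" for i d x
      by (simp add: axis_def algebra_simps sum.distrib sum_distrib_left if_distrib[of "(*) _"]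
          cong: if_cong)
    have nonneg: "partial_deriv i f x \<ge> 0" if x: "x \<in> \<Gamma>" for x i
    proof (rule ccontr)
      let ?S = "\<Sum>j\<in>UNIV. partial_deriv j f x"
      assume neg: "\<not> partial_deriv i f x \<ge> 0"
      \<comment> \<open>With this \<open>d\<close> the gradient pairs to exactly 0 with a vector of
        the positive cone, contradicting \<open>pos\<close>.\<close>
      define d where "d = - partial_deriv i f x / ?S"
      have "d > 0" using neg sum_pos[OF x] by (simp add: d_def divide_neg_pos not_le)
      then have "axis i 1 + d *\<^sub>R 1 \<in> positive_cone"
        by (simp add: positive_cone_def axis_def)
      then have "0 < partial_deriv i f x + d * ?S"
        using pos[OF x, of "axis i 1 + d *\<^sub>R 1"] assms(5) unfolding axis_sum by blast
      then show False using sum_pos[OF x] by (simp add: d_def)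
    qed
    have head: "partial_deriv i f x \<ge> \<theta> * (\<Sum>j\<in>UNIV. partial_deriv j f x)"
      if x: "x \<in> \<Gamma>" and mono: "\<forall>i j. i \<le> j \<longrightarrow> x $ i \<le> x $ j"
        and i: "coord_index i \<le> ?k + 1" for x i
    proof -
      let ?p = "\<lambda>j. partial_deriv j f x"
      let ?I = "{j::'n. coord_index j \<le> ?k}"
      define A B where "A = sum ?p ?I" and "B = sum ?p (- ?I)"
      have S: "sum ?p UNIV = A + B"
        using sum.union_disjoint[of ?I "- ?I" ?p] by (simp add: A_def B_def Compl_partition)
      \<comment> \<open>Pairing the gradient with the perturbed vector bounds the head sum
        \<open>A\<close> by a multiple of the tail sum \<open>B\<close>.\<close>
      have "0 < (\<Sum>j\<in>UNIV. (if j \<in> ?I then - e else 1) * ?p j)"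
        using pos[OF x emem] by (rule back_subst[of "\<lambda>s. 0 < s"]) (auto intro!: sum.cong)
      also have "\<dots> = (\<Sum>j\<in>?I. (if j \<in> ?I then - e else 1) * ?p j)
          + (\<Sum>j\<in>-?I. (if j \<in> ?I then - e else 1) * ?p j)"
        by (subst sum.union_disjoint[symmetric]) (auto simp: Compl_partition)
      also have "\<dots> = - e * A + B"
        by (simp add: A_def B_def sum_distrib_left sum_negf)
      finally have AB: "e * A \<le> B" by simp
      have "B \<le> (\<Sum>j\<in>-?I. ?p i)"
        unfolding B_def
      proof (rule sum_mono)
        fix j assume "j \<in> - ?I"
        \<comment> \<open>If \<open>j < i\<close>, then
          \<open>coord_index j < coord_index i \<le> ?k + 1\<close> would put \<open>j\<close> in
          \<open>?I\<close>. This is where the bound \<open>?k + 1\<close>, rather than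
          \<open>?k\<close>, suffices.\<close>
        then have "i \<le> j"
          using i coord_index_strict_mono[of j i] by (cases "i \<le> j") (auto simp: not_le)
        then show "?p j \<le> ?p i"
          using symmetric_concave_partial_deriv_antimono[OF op assms(3) symf conc D[OF x] x] mono
          by blast
      qed
      also have "\<dots> \<le> (\<Sum>j\<in>(UNIV::'n set). ?p i)"
        using nonneg[OF x] by (intro sum_mono2) auto
      finally have Bn: "B \<le> ?n * ?p i" by simp
      have "e * (A + B) \<le> (1 + e) * B"
        using AB by (simp add: algebra_simps)
      also have "\<dots> \<le> (1 + e) * (?n * ?p i)"
        using Bn e by (intro mult_left_mono) auto
      finally show ?thesis
        using e n unfolding S \<theta>_def by (simp add: divide_le_eq mult_ac)
    qed
    have type2: "fully_uniformly_elliptic \<Gamma> f" if t2: "type2 \<Gamma>"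
    proof -
      obtain d where d: "d > 0" "\<And>i. axis i 1 - d *\<^sub>R 1 \<in> \<Gamma>"
        using type2_uniform_axis_mem[OF assms(1,3,5) t2] by blast
      \<comment> \<open>The test vector singles out one index, so no ordering of the entries of
        \<open>x\<close> enters.\<close>
      have "partial_deriv i f x \<ge> d * (\<Sum>j\<in>UNIV. partial_deriv j f x)" if "x \<in> \<Gamma>" for x i
        using pos[OF that d(2)[of i]] axis_sum[of i "- d" x] by simp
      then show ?thesis
        unfolding fully_uniformly_elliptic_def using d(1) nonneg sum_pos by blast
    qed
    show ?thesis
      by (intro conjI ballI allI impI nonneg sum_pos head type2) simp_all
  qed
  ultimately show ?thesis
    by (intro exI[of _ \<theta>] conjI allI impI) simp_all
qed

end
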